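(* Let $\Gamma$ be an edge-and-vertex-labeled graph (e-v-graph) of size $m$, and let $\Delta_m\in B_m$ be the Garside element. Then $$\Gamma^{*}=\left(\Gamma\,\Delta_m\right)^{\intercal}.$$
   Context: An e-v-graph of order $n$ and size $m$ is a finite loopless graph (multiple edges allowed) with vertex set $[n]$ and $m$ edges labeled bijectively by $[m]$. E-v-graphs correspond bijectively to factorizations $\rho=(\tau_1,\dots,\tau_m)$, i.e. sequences of transpositions in $\mathcal{S}_n$: the edge labeled $i$ joins the two points moved by $\tau_i$. The reverse $\Gamma^{\intercal}$ has the same vertices and edges, with edges relabeled by $i\mapsto m+1-i$. Mind-body dual. For a vertex $v$ the minimally increasing greedy trail (migt) $\overrightarrow{v}$ starts at $v$ along the smallest-labeled edge at $v$; after arriving at a vertex $w$ along an edge $e$ it continues with the smallest-labeled edge at $w$ larger than $e$, and stops if there is none. If $v$ is isolated, $\overrightarrow{v}$ is the trivial trail. Every edge belongs to exactly two migts. $\Gamma^*$ has vertices $v^*=\overrightarrow{v}$, and for each $i$ an edge labeled $i$ joining the two migts that contain the edge of $\Gamma$ labeled $i$; the vertex $v^*$ is given the same label as $v$, so $\Gamma^*$ is again an e-v-graph of order $n$ and size $m$. Braid group and Hurwitz action. $B_m$ is generated by $\sigma_1,\dots,\sigma_{m-1}$ with relations $\sigma_i\sigma_j=\sigma_j\sigma_i$ for $|i-j|>1$ and $\sigma_i\sigma_{i+1}\sigma_i=\sigma_{i+1}\sigma_i\sigma_{i+1}$. It acts on the right on factorizations of length $m$ by: $(\rho\sigma_i)_k=\tau_k$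 for $k\ne i,i+1$, $(\rho\sigma_i)_i=\tau_i\tau_{i+1}\tau_i^{-1}$, $(\rho\sigma_i)_{i+1}=\tau_i$ (permutations multiplied from left to right). The action on e-v-graphs is transferred through the bijection above. For $i<j\le m$ let $\delta_{i,j}:=\sigma_{j-1}\sigma_{j-2}\cdots\sigma_i$; the Garside element is $\Delta_m:=\delta_{1,m}\delta_{2,m}\cdots\delta_{m-1,m}$ (and $\Delta_1=1$). *)

theory Defs
  imports "HOL-Algebra.Group" "HOL-Combinatorics.Perm"
begin

section \<open>E-v-graphs\<close>

text \<open>
  Since the edges are in bijection with their labels, an e-v-graph of order \<open>n\<close> and size \<open>m\<close> is
  given by \<open>n\<close> together with the list of the endpoint sets of the edges labeled \<open>1, ..., m\<close>.
  All labels start at 1, whereas list positions start at 0.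
\<close>

datatype evgraph = EVGraph (vorder: nat) (edges: "nat set list")

definition is_evgraph :: "nat \<Rightarrow> nat \<Rightarrow> evgraph \<Rightarrow> bool" where
  "is_evgraph n m G \<longleftrightarrow> vorder G = n \<and> length (edges G) = m \<and>
     (\<forall>e \<in> set (edges G). e \<subseteq> {1..n} \<and> card e = 2)"

definition esize :: "evgraph \<Rightarrow> nat" where
  "esize G = length (edges G)"

definition ends :: "evgraph \<Rightarrow> nat \<Rightarrow> nat set" where
  "ends G i = edges G ! (i - 1)"

text \<open>Relabeling \<open>i \<mapsto> m + 1 - i\<close> reverses the list of edges.\<close>

definition reverse_evgraph :: "evgraph \<Rightarrow> evgraph" where
  "reverse_evgraph G = EVGraph (vorder G) (rev (edges G))"


section \<open>Minimally increasing greedy trails and the mind-body dual\<close>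

definition edges_after :: "evgraph \<Rightarrow> nat \<Rightarrow> nat \<Rightarrow> nat set" where
  "edges_after G w e = {f \<in> {1..esize G}. w \<in> ends G f \<and> e < f}"

definition opposite :: "evgraph \<Rightarrow> nat \<Rightarrow> nat \<Rightarrow> nat" where
  "opposite G f w = (THE u. u \<in> ends G f \<and> u \<noteq> w)"

text \<open>The labels of the edges traversed greedily after arriving at \<open>w\<close> along the edge \<open>e\<close>.\<close>

function greedy_trail :: "evgraph \<Rightarrow> nat \<Rightarrow> nat \<Rightarrow> nat list" where
  "greedy_trail G w e =
     (if edges_after G w e = {} then []
      else let f = Min (edges_after G w e) in f # greedy_trail G (opposite G f w) f)"
  by auto
termination
proof (relation "measure (\<lambda>(G, w, e). esize G - e)", goal_cases)
  case (2 G w e f)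
  have "finite (edges_after G w e)" by (simp add: edges_after_def)
  with 2 have "f \<in> edges_after G w e" using Min_in by blast
  then show ?case by (auto simp: edges_after_def)
qed simp

declare greedy_trail.simps [simp del]

text \<open>
  A trail is determined by its initial vertex and the labels of its edges. As all labels are
  positive, the previous edge \<open>0\<close> imposes no restriction on the first step.
\<close>

definition migt :: "evgraph \<Rightarrow> nat \<Rightarrow> nat \<times> nat list" where
  "migt G v = (v, greedy_trail G v 0)"

text \<open>The vertex \<open>migt G v\<close> of the dual carries the label \<open>v\<close>.\<close>

definition mind_body_dual :: "evgraph \<Rightarrow> evgraph" where
  "mind_body_dual G = EVGraph (vorder G)
     (map (\<lambda>i. {v \<in> {1..vorder G}. i \<in> set (snd (migt G v))}) [1..<esize G + 1])"


section \<open>Factorizations\<close>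

definition is_transposition :: "nat \<Rightarrow> nat perm \<Rightarrow> bool" where
  "is_transposition n t \<longleftrightarrow> (\<exists>a \<in> {1..n}. \<exists>b \<in> {1..n}. a \<noteq> b \<and> t = Perm.swap a b)"

definition is_factorization :: "nat \<Rightarrow> nat \<Rightarrow> nat perm list \<Rightarrow> bool" where
  "is_factorization n m r \<longleftrightarrow> length r = m \<and> (\<forall>t \<in> set r. is_transposition n t)"

definition graph_of :: "nat \<Rightarrow> nat perm list \<Rightarrow> evgraph" where
  "graph_of n r = EVGraph n (map affected r)"

definition factorization_of :: "evgraph \<Rightarrow> nat perm list" where
  "factorization_of G =
     (THE r. is_factorization (vorder G) (esize G) r \<and> graph_of (vorder G) r = G)"

lemma transposition_eqI:
  assumes "is_transposition n s" "is_transposition n t" "affected s = affected t"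
  shows "s = t"
  using assms by (auto simp: is_transposition_def affected_swap doubleton_eq_iff swap_sym)

lemma is_evgraph_graph_of:
  assumes "is_factorization n m r"
  shows "is_evgraph n m (graph_of n r)"
proof -
  have "affected t \<subseteq> {1..n} \<and> card (affected t) = 2" if "is_transposition n t" for t
    using that by (auto simp: is_transposition_def affected_swap)
  then show ?thesis using assms by (simp add: is_factorization_def is_evgraph_def graph_of_def)
qed

lemma graph_of_inj:
  assumes "is_factorization n m r" "is_factorization n m s" "graph_of n r = graph_of n s"
  shows "r = s"
proof -
  have "inj_on affected (set r \<union> set s)"
    by (rule inj_onI) (use assms in \<open>auto simp: is_factorization_def intro: transposition_eqI\<close>)
  moreover have "map affected r = map affected s"
    using assms(3) by (simp add: graph_of_def)
  ultimately show ?thesis by (simp add: inj_on_map_eq_map)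
qed

lemma graph_of_surj:
  assumes "is_evgraph n m G"
  shows "\<exists>r. is_factorization n m r \<and> graph_of n r = G"
proof -
  have "\<exists>t. is_transposition n t \<and> affected t = e" if e: "e \<in> set (edges G)" for e
  proof -
    have "card e = 2" "e \<subseteq> {1..n}" using assms e by (auto simp: is_evgraph_def)
    then obtain a b where "e = {a, b}" "a \<noteq> b" "a \<in> {1..n}" "b \<in> {1..n}"
      by (auto simp: card_2_iff)
    then have "is_transposition n (Perm.swap a b)" "affected (Perm.swap a b) = e"
      unfolding is_transposition_def by (blast, simp add: affected_swap)
    then show ?thesis by blast
  qed
  then have "\<forall>e \<in> set (edges G). \<exists>t. is_transposition n t \<and> affected t = e" by blast
  then obtain f where f: "\<forall>e \<in> set (edges G). is_transposition n (f e) \<and> affected (f e) = e"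
    by (rule bchoice[THEN exE])
  have "is_factorization n m (map f (edges G))"
    using f assms by (auto simp: is_factorization_def is_evgraph_def)
  moreover have "graph_of n (map f (edges G)) = G"
    using f assms by (cases G) (simp add: graph_of_def is_evgraph_def map_idI)
  ultimately show ?thesis by blast
qed

lemma bij_betw_graph_of:
  "bij_betw (graph_of n) {r. is_factorization n m r} {G. is_evgraph n m G}"
proof (rule bij_betw_imageI)
  show "inj_on (graph_of n) {r. is_factorization n m r}"
    by (rule inj_onI) (metis graph_of_inj mem_Collect_eq)
  show "graph_of n ` {r. is_factorization n m r} = {G. is_evgraph n m G}"
    using is_evgraph_graph_of graph_of_surj by blast
qed

lemma factorization_of_graph_of:
  assumes "is_factorization n m r"
  shows "factorization_of (graph_of n r) = r"
proof -
  have "vorder (graph_of n r) = n" "esize (graph_of n r) = m"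
    using assms by (auto simp: graph_of_def esize_def is_factorization_def)
  then show ?thesis
    unfolding factorization_of_def using assms graph_of_inj[OF _ assms] by (intro the_equality) simp_all
qed

lemma factorization_of:
  assumes "is_evgraph n m G"
  shows "is_factorization n m (factorization_of G)" "graph_of n (factorization_of G) = G"
  using graph_of_surj[OF assms] factorization_of_graph_of by metis+


section \<open>Braid groups\<close>

text \<open>
  The group presented by the given generators and relations: words in the letters \<open>(i, True)\<close>,
  for \<open>\<sigma>\<^sub>i\<close>, and \<open>(i, False)\<close>, for \<open>\<sigma>\<^sub>i\<^sup>-\<^sup>1\<close>, modulo the congruence generated by free cancellation
  and the braid relations.
\<close>

type_synonym braid_word = "(nat \<times> bool) list"

definition braid_words :: "nat \<Rightarrow> braid_word set" where
  "braid_words m = lists ({i. 1 \<le> i \<and> i < m} \<times> UNIV)"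

inductive braid_cong :: "nat \<Rightarrow> braid_word \<Rightarrow> braid_word \<Rightarrow> bool" for m where
  refl: "u \<in> braid_words m \<Longrightarrow> braid_cong m u u"
| sym: "braid_cong m u v \<Longrightarrow> braid_cong m v u"
| trans: "braid_cong m u v \<Longrightarrow> braid_cong m v w \<Longrightarrow> braid_cong m u w"
| append: "braid_cong m u u' \<Longrightarrow> braid_cong m v v' \<Longrightarrow> braid_cong m (u @ v) (u' @ v')"
| cancel: "1 \<le> i \<Longrightarrow> i < m \<Longrightarrow> braid_cong m [(i, b), (i, \<not> b)] []"
| far: "1 \<le> i \<Longrightarrow> i + 1 < j \<Longrightarrow> j < m \<Longrightarrow>
    braid_cong m [(i, True), (j, True)] [(j, True), (i, True)]"
| braid: "1 \<le> i \<Longrightarrow> i + 1 < m \<Longrightarrow>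
    braid_cong m [(i, True), (i + 1, True), (i, True)] [(i + 1, True), (i, True), (i + 1, True)]"

definition braid_class :: "nat \<Rightarrow> braid_word \<Rightarrow> braid_word set" where
  "braid_class m u = {v. braid_cong m u v}"

definition braid_group :: "nat \<Rightarrow> braid_word set monoid" where
  "braid_group m =
     \<lparr>carrier = braid_class m ` braid_words m,
      monoid.mult = (\<lambda>A B. \<Union>u \<in> A. \<Union>v \<in> B. braid_class m (u @ v)),
      one = braid_class m []\<rparr>"

lemma braid_cong_words:
  "braid_cong m u v \<Longrightarrow> u \<in> braid_words m \<and> v \<in> braid_words m"
  by (induction rule: braid_cong.induct) (auto simp: braid_words_def)

lemma braid_words_simps [simp]:
  "[] \<in> braid_words m"
  "(i, b) # u \<in> braid_words m \<longleftrightarrow> 1 \<le> i \<and> i < m \<and> u \<in> braid_words m"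
  "u @ v \<in> braid_words m \<longleftrightarrow> u \<in> braid_words m \<and> v \<in> braid_words m"
  by (auto simp: braid_words_def)

lemma braid_class_eq_iff:
  assumes "u \<in> braid_words m"
  shows "braid_class m u = braid_class m v \<longleftrightarrow> braid_cong m u v"
proof
  assume "braid_class m u = braid_class m v"
  then have "u \<in> braid_class m v"
    using braid_cong.refl[OF assms] by (auto simp: braid_class_def)
  then show "braid_cong m u v" by (auto simp: braid_class_def intro: braid_cong.sym)
qed (auto simp: braid_class_def intro: braid_cong.sym braid_cong.trans)

lemma braid_mult_class:
  assumes "u \<in> braid_words m" "v \<in> braid_words m"
  shows "braid_class m u \<otimes>\<^bsub>braid_group m\<^esub> braid_class m v = braid_class m (u @ v)"
proof -
  have 1: "braid_class m (u' @ v') = braid_class m (u @ v)"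
    if "u' \<in> braid_class m u" "v' \<in> braid_class m v" for u' v'
  proof -
    have "braid_cong m (u @ v) (u' @ v')"
      using that by (intro braid_cong.append) (simp_all add: braid_class_def)
    then show ?thesis using assms braid_class_eq_iff[of "u @ v" m "u' @ v'"] by simp
  qed
  have 2: "u \<in> braid_class m u" "v \<in> braid_class m v"
    using assms by (auto simp: braid_class_def intro: braid_cong.refl)
  have "(\<Union>u' \<in> braid_class m u. \<Union>v' \<in> braid_class m v. braid_class m (u' @ v')) =
      braid_class m (u @ v)"
    using 1 2 by blast
  then show ?thesis by (simp add: braid_group_def)
qed

lemma braid_one: "\<one>\<^bsub>braid_group m\<^esub> = braid_class m []"
  by (simp add: braid_group_def)

lemma carrier_braid_group: "carrier (braid_group m) = braid_class m ` braid_words m"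
  by (simp add: braid_group_def)

lemma braid_inverse_word:
  "u \<in> braid_words m \<Longrightarrow>
     \<exists>v \<in> braid_words m. braid_cong m (v @ u) []"
proof (induction u)
  case Nil
  then show ?case by (intro bexI[of _ "[]"]) (auto intro: braid_cong.refl)
next
  case (Cons a u)
  obtain i b where a: "a = (i, b)" by fastforce
  have i: "1 \<le> i" "i < m" and u: "u \<in> braid_words m" using Cons.prems a by auto
  obtain v where v: "v \<in> braid_words m" "braid_cong m (v @ u) []"
    using Cons.IH u by blast
  have "braid_cong m ([(i, \<not> b), (i, b)] @ u) ([] @ u)"
    using braid_cong.append[OF braid_cong.cancel[OF i, of "\<not> b"] braid_cong.refl[OF u]] by simp
  then have "braid_cong m (v @ [(i, \<not> b), (i, b)] @ u) (v @ u)"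
    using braid_cong.append[OF braid_cong.refl[OF v(1)]] by simp
  then have "braid_cong m ((v @ [(i, \<not> b)]) @ a # u) []"
    using v(2) a braid_cong.trans by simp
  then show ?case using v(1) i by (intro bexI[of _ "v @ [(i, \<not> b)]"]) auto
qed

lemma group_braid_group: "group (braid_group m)"
proof (rule groupI)
  fix x assume "x \<in> carrier (braid_group m)"
  then obtain u where u: "u \<in> braid_words m" "x = braid_class m u"
    by (auto simp: carrier_braid_group)
  obtain v where v: "v \<in> braid_words m" "braid_cong m (v @ u) []"
    using braid_inverse_word u(1) by blast
  show "\<exists>y \<in> carrier (braid_group m). y \<otimes>\<^bsub>braid_group m\<^esub> x = \<one>\<^bsub>braid_group m\<^esub>"
    using u v by (intro bexI[of _ "braid_class m v"])
      (auto simp: braid_mult_class braid_one braid_class_eq_iff carrier_braid_group)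
qed (auto simp: carrier_braid_group braid_one braid_mult_class)

definition sigma :: "nat \<Rightarrow> nat \<Rightarrow> braid_word set" where
  "sigma m i = braid_class m [(i, True)]"

definition braid_prod :: "nat \<Rightarrow> braid_word set list \<Rightarrow> braid_word set" where
  "braid_prod m xs = foldr (\<lambda>x y. x \<otimes>\<^bsub>braid_group m\<^esub> y) xs \<one>\<^bsub>braid_group m\<^esub>"

definition delta :: "nat \<Rightarrow> nat \<Rightarrow> nat \<Rightarrow> braid_word set" where
  "delta m i j = braid_prod m (map (sigma m) (rev [i..<j]))"

definition garside :: "nat \<Rightarrow> braid_word set" where
  "garside m = braid_prod m (map (\<lambda>i. delta m i m) [1..<m])"


section \<open>The Hurwitz action\<close>

text \<open>Permutations are multiplied from left to right, unlike in \<^theory>\<open>HOL-Combinatorics.Perm\<close>.\<close>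

definition lr_mult :: "'a perm \<Rightarrow> 'a perm \<Rightarrow> 'a perm"  (infixl \<open>\<star>\<close> 70) where
  "s \<star> t = t * s"

text \<open>The second equation is the inverse of the first one.\<close>

fun hurwitz_letter :: "'a perm list \<Rightarrow> nat \<times> bool \<Rightarrow> 'a perm list" where
  "hurwitz_letter r (i, True) =
     r[i - 1 := r ! (i - 1) \<star> r ! i \<star> inverse (r ! (i - 1)), i := r ! (i - 1)]"
| "hurwitz_letter r (i, False) =
     r[i - 1 := r ! i, i := inverse (r ! i) \<star> r ! (i - 1) \<star> r ! i]"

definition hurwitz_word :: "'a perm list \<Rightarrow> braid_word \<Rightarrow> 'a perm list" where
  "hurwitz_word r u = foldl hurwitz_letter r u"

text \<open>All words in a braid act in the same way, see \<open>hurwitz_class\<close> below.\<close>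

definition hurwitz :: "'a perm list \<Rightarrow> braid_word set \<Rightarrow> 'a perm list" where
  "hurwitz r b = the_elem (hurwitz_word r ` b)"

definition hurwitz_evgraph :: "evgraph \<Rightarrow> braid_word set \<Rightarrow> evgraph" where
  "hurwitz_evgraph G b = graph_of (vorder G) (hurwitz (factorization_of G) b)"

lemma length_hurwitz_letter [simp]: "length (hurwitz_letter r a) = length r"
  by (cases "(r, a)" rule: hurwitz_letter.cases) auto

lemma length_hurwitz_word [simp]: "length (hurwitz_word r u) = length r"
  unfolding hurwitz_word_def by (induction u arbitrary: r) auto

lemma hurwitz_word_append: "hurwitz_word r (u @ v) = hurwitz_word (hurwitz_word r u) v"
  by (simp add: hurwitz_word_def)

lemma perm_inverse_cancel:
  fixes x y :: "'a perm"
  shows "inverse x * (x * y) = y" "x * (inverse x * y) = y"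
  by (simp_all flip: mult.assoc)

lemma hurwitz_word_cong:
  "braid_cong m u v \<Longrightarrow> length r = m \<Longrightarrow> hurwitz_word r u = hurwitz_word r v"
proof (induction arbitrary: r rule: braid_cong.induct)
  case (sym u v)
  then show ?case by metis
next
  case (trans u v w)
  then show ?case by metis
next
  case (append u u' v v')
  then have "hurwitz_word r u = hurwitz_word r u'" by blast
  moreover have "hurwitz_word (hurwitz_word r u') v = hurwitz_word (hurwitz_word r u') v'"
    using append by (metis length_hurwitz_word)
  ultimately show ?case by (simp add: hurwitz_word_append)
next
  case (cancel i b)
  then obtain k where i: "i = Suc k" by (cases i) auto
  show ?case
  proof (rule nth_equalityI)
    fix l assume "l < length (hurwitz_word r [(i, b), (i, \<not> b)])"
    then show "hurwitz_word r [(i, b), (i, \<not> b)] ! l = hurwitz_word r [] ! l"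
      using cancel i
      by (cases b; cases "l = k"; cases "l = Suc k")
        (simp_all add: hurwitz_word_def lr_mult_def mult.assoc perm_inverse_cancel)
  qed simp
next
  case (far i j)
  then obtain k p where i: "i = Suc k" and j: "j = Suc p" by (cases i; cases j) auto
  show ?case
  proof (rule nth_equalityI)
    fix l assume "l < length (hurwitz_word r [(i, True), (j, True)])"
    then show "hurwitz_word r [(i, True), (j, True)] ! l = hurwitz_word r [(j, True), (i, True)] ! l"
      using far i j
      by (cases "l = k"; cases "l = Suc k"; cases "l = p"; cases "l = Suc p")
        (simp_all add: hurwitz_word_def)
  qed simp
next
  case (braid i)
  then obtain k where i: "i = Suc k" by (cases i) auto
  show ?case
  proof (rule nth_equalityI)
    fix l assume "l < length (hurwitz_word r [(i, True), (i + 1, True), (i, True)])"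
    then show "hurwitz_word r [(i, True), (i + 1, True), (i, True)] ! l =
        hurwitz_word r [(i + 1, True), (i, True), (i + 1, True)] ! l"
      using braid i
      by (cases "l = k"; cases "l = Suc k"; cases "l = Suc (Suc k)")
        (simp_all add: hurwitz_word_def lr_mult_def mult.assoc perm_inverse_cancel)
  qed simp
qed simp

lemma hurwitz_class:
  assumes "u \<in> braid_words m" "length r = m"
  shows "hurwitz r (braid_class m u) = hurwitz_word r u"
proof -
  have "hurwitz_word r ` braid_class m u = {hurwitz_word r u}"
  proof -
    have "hurwitz_word r v = hurwitz_word r u" if "v \<in> braid_class m u" for v
      using that hurwitz_word_cong[of m u v r] assms(2) by (simp add: braid_class_def)
    moreover have "u \<in> braid_class m u"
      using braid_cong.refl[OF assms(1)] by (simp add: braid_class_def)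
    ultimately show ?thesis by blast
  qed
  then show ?thesis by (simp add: hurwitz_def)
qed

lemma hurwitz_one: "hurwitz r \<one>\<^bsub>braid_group (length r)\<^esub> = r"
  by (simp add: braid_one hurwitz_class) (simp add: hurwitz_word_def)

lemma hurwitz_mult:
  assumes "length r = m" "b \<in> carrier (braid_group m)" "c \<in> carrier (braid_group m)"
  shows "hurwitz r (b \<otimes>\<^bsub>braid_group m\<^esub> c) = hurwitz (hurwitz r b) c"
  using assms
  by (auto simp: carrier_braid_group braid_mult_class hurwitz_class hurwitz_word_append)

lemma hurwitz_sigma:
  assumes "1 \<le> i" "i < length r"
  shows "hurwitz r (sigma (length r) i) =
     r[i - 1 := r ! (i - 1) \<star> r ! i \<star> inverse (r ! (i - 1)), i := r ! (i - 1)]"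
  using assms by (simp add: sigma_def hurwitz_class) (simp add: hurwitz_word_def)

end

theory Submission
  imports Defs
begin

text \<open>
  Let \<open>\<rho> = (\<tau>\<^sub>1, ..., \<tau>\<^sub>m)\<close> be the factorization of \<open>\<Gamma>\<close>. The proof computes both sides of the equation
  in terms of the partial products \<open>\<pi>\<^sub>i = \<tau>\<^sub>1 \<cdots> \<tau>\<^sub>i\<^sub>-\<^sub>1\<close>, multiplied from left to right.

  Garside side. The braid \<open>\<delta>\<^sub>i\<^sub>,\<^sub>m\<close> carries the last entry of a factorization leftwards to position
  \<open>i\<close>. Each entry \<open>s\<close> that it passes conjugates it and is itself only shifted by one place
  (\<open>hurwitz_word_delta_word\<close>). Thus \<open>\<Delta>\<^sub>m\<close> first brings \<open>\<tau>\<^sub>m\<close> to the front, conjugated by \<open>\<pi>\<^sub>m\<close>, then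
  \<open>\<tau>\<^sub>m\<^sub>-\<^sub>1\<close> to the second place, conjugated by \<open>\<pi>\<^sub>m\<^sub>-\<^sub>1\<close>, and so on. So the entries of \<open>\<rho> \<Delta>\<^sub>m\<close>, read from
  right to left, are the conjugates \<open>\<pi>\<^sub>i \<tau>\<^sub>i \<pi>\<^sub>i\<^sup>-\<^sup>1\<close> (\<open>hurwitz_garside\<close>). The edge labeled \<open>i\<close> of the
  reversed graph therefore joins the two vertices \<open>v\<close> that \<open>\<pi>\<^sub>i\<close> maps to an end of the edge labeled
  \<open>i\<close> of \<open>\<Gamma>\<close>.

  Dual side. Let a token start at \<open>v\<close>, and let \<open>\<tau>\<^sub>1, \<tau>\<^sub>2, ...\<close> act on it one after the other. The
  token moves at exactly those times at which it sits at an end of the current edge, and then it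
  crosses this edge. Hence it runs along the migt of \<open>v\<close>, and at time \<open>i\<close> it sits at the image of
  \<open>v\<close> under \<open>\<pi>\<^sub>i\<close>. So this migt contains the edge labeled \<open>i\<close> if and only if \<open>\<pi>\<^sub>i\<close> maps \<open>v\<close> to an end
  of that edge (\<open>mem_greedy_trail_iff\<close>), which is the condition found on the Garside side.
\<close>

section \<open>The Garside element as a word\<close>

definition delta_word :: "nat \<Rightarrow> nat \<Rightarrow> braid_word" where
  "delta_word i j = map (\<lambda>k. (k, True)) (rev [i..<j])"

definition garside_word :: "nat \<Rightarrow> nat \<Rightarrow> braid_word" where
  "garside_word p m = concat (map (\<lambda>i. delta_word i m) [p..<m])"

lemma braid_prod_classes:
  assumes "set us \<subseteq> braid_words m"
  shows "braid_prod m (map (braid_class m) us) = braid_class m (concat us)"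
    and "concat us \<in> braid_words m"
  using assms by (induction us) (auto simp: braid_prod_def braid_one braid_mult_class)

lemma delta_word_in_braid_words: "1 \<le> i \<Longrightarrow> j \<le> m \<Longrightarrow> delta_word i j \<in> braid_words m"
  by (auto simp: delta_word_def braid_words_def)

lemma delta_eq_class:
  assumes "1 \<le> i" "j \<le> m"
  shows "delta m i j = braid_class m (delta_word i j)"
proof -
  let ?us = "map (\<lambda>k. [(k, True)]) (rev [i..<j])"
  have us: "set ?us \<subseteq> braid_words m" using assms by auto
  have "map (sigma m) (rev [i..<j]) = map (braid_class m) ?us"
    by (simp add: sigma_def)
  moreover have "concat ?us = delta_word i j"
    by (simp add: delta_word_def)
  ultimately show ?thesis
    using braid_prod_classes(1)[OF us] unfolding delta_def by metis
qed

lemma garside_eq_class: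
  "garside m = braid_class m (garside_word 1 m)" "garside_word 1 m \<in> braid_words m"
proof -
  let ?us = "map (\<lambda>i. delta_word i m) [1..<m]"
  have us: "set ?us \<subseteq> braid_words m"
    by (auto intro: delta_word_in_braid_words)
  have "map (\<lambda>i. delta m i m) [1..<m] = map (braid_class m) ?us"
    by (simp add: delta_eq_class)
  then show "garside m = braid_class m (garside_word 1 m)"
    using braid_prod_classes(1)[OF us] unfolding garside_def garside_word_def by metis
  show "garside_word 1 m \<in> braid_words m"
    using braid_prod_classes(2)[OF us] by (simp add: garside_word_def)
qed


section \<open>The Hurwitz action of the Garside element\<close>

text \<open>
  This is \<open>\<pi> t \<pi>\<^sup>-\<^sup>1\<close>, where \<open>\<pi>\<close> is the product of \<open>r\<close> from left to right. As a fold it conjugates by the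
  last entry of \<open>r\<close> first, which is the order in which the generators \<open>\<sigma>\<^sub>k\<close> in \<open>\<delta>\<^sub>i\<^sub>,\<^sub>m\<close> act.
\<close>

definition conjugate :: "'a perm list \<Rightarrow> 'a perm \<Rightarrow> 'a perm" where
  "conjugate r t = foldr (\<lambda>s x. s \<star> x \<star> inverse s) r t"

lemma hurwitz_letter_append:
  "hurwitz_letter (xs @ s # t # ys) (Suc (length xs), True) = xs @ (s \<star> t \<star> inverse s) # s # ys"
  by (simp add: nth_append list_update_append)

text \<open>
  The first letter of the word exchanges \<open>t\<close> with its left neighbour, the last entry of \<open>r\<close>. What
  remains is the same situation for a shorter \<open>r\<close>, where this neighbour has joined \<open>ys\<close>: hence the
  arbitrary context \<open>xs\<close>, \<open>ys\<close> and the induction from the right end.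
\<close>

lemma hurwitz_word_delta_word:
  "hurwitz_word (xs @ r @ t # ys) (delta_word (Suc (length xs)) (Suc (length xs + length r))) =
     xs @ conjugate r t # r @ ys"
proof (induction r arbitrary: t ys rule: rev_induct)
  case Nil
  then show ?case by (simp add: delta_word_def hurwitz_word_def conjugate_def)
next
  case (snoc s r)
  let ?p = "length xs"
  have "delta_word (Suc ?p) (Suc (?p + length (r @ [s]))) =
      (Suc (length (xs @ r)), True) # delta_word (Suc ?p) (Suc (?p + length r))"
    by (simp add: delta_word_def)
  moreover have "hurwitz_letter (xs @ (r @ [s]) @ t # ys) (Suc (length (xs @ r)), True) =
      xs @ r @ (s \<star> t \<star> inverse s) # s # ys"
    using hurwitz_letter_append[of "xs @ r" s t ys] by simp
  ultimately show ?case
    using snoc.IH[of "s \<star> t \<star> inverse s" "s # ys"]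
    by (simp add: hurwitz_word_def conjugate_def)
qed

text \<open>
  After \<open>\<delta>\<^sub>i\<^sub>,\<^sub>m\<close> has moved the last entry to position \<open>i\<close>, the remaining factors of the Garside element
  act only to the right of this entry, on the shortened factorization. The finished entries are
  collected in \<open>xs\<close>.
\<close>

lemma hurwitz_word_garside_word:
  "hurwitz_word (xs @ r) (garside_word (Suc (length xs)) (length xs + length r)) =
     xs @ rev (map (\<lambda>i. conjugate (take i r) (r ! i)) [0..<length r])"
proof (induction r arbitrary: xs rule: rev_induct)
  case Nil
  then show ?case by (simp add: garside_word_def hurwitz_word_def)
next
  case (snoc t r)
  let ?p = "length xs" and ?m = "length xs + length (r @ [t])"
  have "garside_word (Suc ?p) ?m = delta_word (Suc ?p) ?m @ garside_word (Suc (Suc ?p)) ?m"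
    \<comment> \<open>If \<open>r\<close> is empty, then all three words are empty.\<close>
    by (cases r) (simp_all add: garside_word_def delta_word_def upt_rec)
  then have "hurwitz_word (xs @ r @ [t]) (garside_word (Suc ?p) ?m) =
      hurwitz_word ((xs @ [conjugate r t]) @ r) (garside_word (Suc (Suc ?p)) ?m)"
    using hurwitz_word_delta_word[of xs r t "[]"] by (simp add: hurwitz_word_append)
  also have "\<dots> = xs @ conjugate r t # rev (map (\<lambda>i. conjugate (take i r) (r ! i)) [0..<length r])"
    using snoc.IH[of "xs @ [conjugate r t]"] by simp
  finally show ?case by (simp add: nth_append)
qed

lemma hurwitz_garside:
  "hurwitz r (garside (length r)) =
     rev (map (\<lambda>i. conjugate (take i r) (r ! i)) [0..<length r])"
  using hurwitz_word_garside_word[of "[]" r]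
    hurwitz_class[OF garside_eq_class(2)[of "length r"] HOL.refl]
  by (simp add: garside_eq_class(1))

lemma affected_conjugate:
  "affected (conjugate r t) = {v. fold Perm.apply r v \<in> affected t}"
proof (induction r)
  case Nil
  then show ?case by (simp add: conjugate_def)
next
  case (Cons s r)
  \<comment> \<open>Read from left to right, \<open>s \<star> x \<star> inverse s\<close> fixes \<open>v\<close> if and only if \<open>x\<close> fixes the image of \<open>v\<close> under \<open>s\<close>.\<close>
  have "v \<in> affected (s \<star> x \<star> inverse s) \<longleftrightarrow> Perm.apply s v \<in> affected x" for v and x :: "'a perm"
    using bij_inv_eq_iff[OF bij_apply[of s], of v "Perm.apply x (Perm.apply s v)"]
    by (auto simp: in_affected lr_mult_def apply_inverse apply_times)
  with Cons show ?case by (auto simp: conjugate_def)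
qed


section \<open>Greedy trails as orbits of a token\<close>

lemma edges_graph_of [simp]:
  "vorder (graph_of n r) = n" "esize (graph_of n r) = length r"
  "i < length r \<Longrightarrow> ends (graph_of n r) (Suc i) = affected (r ! i)"
  by (simp_all add: graph_of_def esize_def ends_def)

text \<open>
  Looking for the smallest edge after \<open>e\<close> amounts to testing the labels \<open>e + 1, e + 2, ...\<close> one by
  one. This form of the recursion follows the factorization step by step.
\<close>

lemma greedy_trail_step:
  assumes "e < esize G"
  shows "greedy_trail G w e =
    (if w \<in> ends G (Suc e) then Suc e # greedy_trail G (opposite G (Suc e) w) (Suc e)
     else greedy_trail G w (Suc e))"
proof (cases "w \<in> ends G (Suc e)")
  case True
  have "Suc e \<in> edges_after G w e" using True assms by (auto simp: edges_after_def)
  moreover have "Min (edges_after G w e) = Suc e"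
    using True assms by (intro Min_eqI) (auto simp: edges_after_def)
  ultimately show ?thesis using True by (subst greedy_trail.simps) (auto simp: Let_def)
next
  case False
  have "edges_after G w e = edges_after G w (Suc e)"
    using False by (auto simp: edges_after_def) (metis Suc_lessI)
  then show ?thesis
    using False greedy_trail.simps[of G w e] greedy_trail.simps[of G w "Suc e"] by simp
qed

lemma apply_transposition_eq_opposite:
  assumes "is_transposition k (r ! e)" "e < length r" "w \<in> affected (r ! e)"
  shows "Perm.apply (r ! e) w = opposite (graph_of n r) (Suc e) w"
proof -
  obtain a b where ab: "a \<noteq> b" "r ! e = Perm.swap a b"
    using assms(1) by (auto simp: is_transposition_def)
  then show ?thesis
    using assms(2,3) unfolding opposite_def
    by (intro the_equality[symmetric]) (auto simp: affected_swap)
qed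

text \<open>
  The list \<open>drop e (take (i - 1) r)\<close> consists of the transpositions with labels strictly between
  \<open>e\<close> and \<open>i\<close>. A token that is at \<open>w\<close> after time \<open>e\<close> meets each label in turn: if it is at an end
  of the edge, both the token and the greedy trail cross it, otherwise neither moves.
\<close>

lemma mem_greedy_trail_iff:
  assumes "\<forall>t \<in> set r. is_transposition k t" "e \<le> length r"
  shows "i \<in> set (greedy_trail (graph_of n r) w e) \<longleftrightarrow>
    e < i \<and> i \<le> length r \<and> fold Perm.apply (drop e (take (i - 1) r)) w \<in> affected (r ! (i - 1))"
  using assms(2)
proof (induction e arbitrary: w rule: inc_induct)
  case base
  have "edges_after (graph_of n r) w (length r) = {}" by (auto simp: edges_after_def)
  then show ?case by (subst greedy_trail.simps) simp
next
  case (step e)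
  let ?G = "graph_of n r" and ?w' = "Perm.apply (r ! e) w"
  have trans: "is_transposition k (r ! e)" using assms(1) step.hyps by simp
  have trail: "set (greedy_trail ?G w e) =
      (if w \<in> affected (r ! e) then {Suc e} else {}) \<union> set (greedy_trail ?G ?w' (Suc e))"
    using step.hyps apply_transposition_eq_opposite[OF trans, of w n]
    by (simp add: greedy_trail_step in_affected)
  show ?case
  proof (cases "Suc e < i \<and> i \<le> length r")
    case True
    then have "drop e (take (i - 1) r) = r ! e # drop (Suc e) (take (i - 1) r)"
      by (subst Cons_nth_drop_Suc[symmetric]) auto
    then show ?thesis using True trail step.IH by simp
  next
    case False
    then show ?thesis using trail step.IH step.hyps by (auto simp: not_less le_Suc_eq)
  qed
qed

text \<open>
  A token that starts outside of the vertex set never moves, so it never meets an edge. Hence the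
  dual, whose vertices are restricted to \<open>{1..n}\<close>, misses no end of a conjugate.
\<close>

lemma affected_conjugate_subset:
  assumes "affected t \<subseteq> A" "\<And>s. s \<in> set r \<Longrightarrow> affected s \<subseteq> A"
  shows "affected (conjugate r t) \<subseteq> A"
proof -
  have "fold Perm.apply r v = v" if "v \<notin> A" for v
    using assms(2)
  proof (induction r)
    case (Cons s r)
    then have "v \<notin> affected s" using that by auto
    with Cons show ?case by (simp add: in_affected)
  qed simp
  then show ?thesis using assms(1) by (auto simp: affected_conjugate) (metis subsetD)
qed

lemma affected_transposition_subset: "is_transposition n t \<Longrightarrow> affected t \<subseteq> {1..n}"
  by (auto simp: is_transposition_def affected_swap)

lemma mind_body_dual_graph_of:
  assumes "\<forall>t \<in> set r. is_transposition n t"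
  shows "edges (mind_body_dual (graph_of n r)) =
    map (\<lambda>i. affected (conjugate (take i r) (r ! i))) [0..<length r]"
proof (rule nth_equalityI)
  show "length (edges (mind_body_dual (graph_of n r))) =
      length (map (\<lambda>i. affected (conjugate (take i r) (r ! i))) [0..<length r])"
    by (simp add: mind_body_dual_def del: upt_Suc)
next
  fix i assume "i < length (edges (mind_body_dual (graph_of n r)))"
  then have i: "i < length r" by (simp add: mind_body_dual_def del: upt_Suc)
  have "affected (conjugate (take i r) (r ! i)) \<subseteq> {1..n}"
    using assms i by (intro affected_conjugate_subset affected_transposition_subset)
      (auto dest: in_set_takeD)
  then have "{v \<in> {1..n}. Suc i \<in> set (greedy_trail (graph_of n r) v 0)} =
      affected (conjugate (take i r) (r ! i))"
    using i mem_greedy_trail_iff[OF assms, of 0 "Suc i" n] by (auto simp: affected_conjugate)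
  then show "edges (mind_body_dual (graph_of n r)) ! i =
      map (\<lambda>i. affected (conjugate (take i r) (r ! i))) [0..<length r] ! i"
    using i by (simp add: mind_body_dual_def migt_def del: upt_Suc)
qed


section \<open>The mind-body dual as a Garside twist\<close>

theorem theorem3p4:
  fixes \<Gamma> :: evgraph and n m :: nat
  assumes "is_evgraph n m \<Gamma>"
  shows "mind_body_dual \<Gamma> = reverse_evgraph (hurwitz_evgraph \<Gamma> (garside m))"
proof -
  define r where "r = factorization_of \<Gamma>"
  have r: "is_factorization n m r" and G: "\<Gamma> = graph_of n r"
    using factorization_of[OF assms] by (simp_all add: r_def)
  have m: "m = length r" and trans: "\<forall>t \<in> set r. is_transposition n t"
    using r by (auto simp: is_factorization_def)
  have "hurwitz_evgraph \<Gamma> (garside m) =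
      graph_of n (rev (map (\<lambda>i. conjugate (take i r) (r ! i)) [0..<length r]))"
    unfolding hurwitz_evgraph_def r_def[symmetric] using hurwitz_garside[of r] by (simp add: G m)
  then have "reverse_evgraph (hurwitz_evgraph \<Gamma> (garside m)) =
      EVGraph n (map (\<lambda>i. affected (conjugate (take i r) (r ! i))) [0..<length r])"
    by (simp add: reverse_evgraph_def graph_of_def rev_map comp_def)
  also have "\<dots> = EVGraph n (edges (mind_body_dual \<Gamma>))"
    using mind_body_dual_graph_of[OF trans] by (simp add: G)
  also have "\<dots> = mind_body_dual \<Gamma>"
    by (simp add: mind_body_dual_def G)
  finally show ?thesis by simp
qed

end
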